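(* Let $L_g$ be the relevant ground program for some ProbLog program $L$ with respect to query atoms $\mathbf{Q}$ and evidence $\mathbf{E}=\mathbf{e}$, where $P_{L_g}(\mathbf{E}=\mathbf{e})>0$. Let $\mathcal{M}$ be the ground Markov Logic Network corresponding to the weighted CNF derived from $L_g$. Then the distribution $P(\mathbf{Q})$ according to $\mathcal{M}$ is the same as the distribution $P(\mathbf{Q}\mid\mathbf{E}=\mathbf{e})$ according to $L_g$; that is, for every joint truth-value assignment $\mathbf{q}$ to $\mathbf{Q}$, $$P_{\mathcal{M}}(\mathbf{Q}=\mathbf{q})=P_{L_g}(\mathbf{Q}=\mathbf{q}\mid\mathbf{E}=\mathbf{e}).$$
   Context: **Logic programs.** A (normal) logic program is a set of rules $h \leftarrow b_1,\dots,b_n$, where the head $h$ is an atom and the body literals $b_i$ are atoms or negated atoms. A fact is a rule with empty (true) body. Rules are universally quantified and are identified with their groundings over the Herbrand universe. $WFM(P)$ denotes the (in general three-valued) well-founded model of a logic program $P$; for negation-free $P$ it is the least Herbrand model. A *world* is a (two-valued) assignment of truth values to all ground atoms under consideration. **ProbLog programs.** A ProbLog program $L$ consists of a set of probabilistic facts $p::f$ ($f$ an atom, $p\in[0,1]$) and a set $R$ of logic program rules. Ground instances of the facts $f$ are called ground probabilistic atoms; ground instances of rule heads are called derived atoms. These two sets must be disjoint. Each ground probabilistic atom $f$ has one associated probability $p_f$, and there are finitely many ground probabilistic atoms. The query set $\mathbf{Q}$ and evidence set $\mathbf{E}$ are sets of ground probabilistic or derived atoms, and $\mathbf{e}$ is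 a vector of truth values for $\mathbf{E}$. **Semantics.** A *total choice* $C$ is a subset of the set $F$ of ground probabilistic atoms; its probability is $\prod_{f\in C}p_f\prod_{f\in F\setminus C}(1-p_f)$. A world $\omega$ is a *model* of $L$ if $WFM(C\cup R)=\omega$ for some total choice $C$ (then $C$ is the set of probabilistic atoms true in $\omega$). $MOD(L)$ is the set of models of $L$. $P_L(\omega)$ is the probability of this $C$ if $\omega\in MOD(L)$, and $0$ otherwise. The probability of an event is the sum of $P_L(\omega)$ over the worlds satisfying it, and conditional probabilities are the corresponding ratios. Standing assumption: for the given program $L$, $WFM(C\cup R)$ is two-valued for every total choice $C$. The same definitions of $MOD$ and $P$ are applied to $L_g$. **Relevant ground program.** A ground rule is *inactive* if its body contains a literal that is false in the evidence $\mathbf{E}=\mathbf{e}$ (an atom of $\mathbf{E}$ false in $\mathbf{e}$, or the negation of an atom of $\mathbf{E}$ true in $\mathbf{e}$). The *relevant atoms* form the smallest set of ground atoms that contains $\mathbf{Q}\cup\mathbf{E}$ and contains every atom occurring (positively or negatively) in the body of any ground rule of $L$ that is not inactive and whose head is in the set. $L_g$ is the ground ProbLog program whose rules are the ground rules of $L$ that are not inactive and have a relevant head, and whose probabilistic facts are the ground probabilistic facts $p_f::f$ of $L$ with $f$ relevant. Worlds of $L_g$ are truth assignments to the relevant atoms. $L_g$ is assumed finite (finitely many relevant atoms and rules). **CNF derived from $L_g$.** $\varphi_r$ is a propositional CNF obtained from the rules of $L_g$ by an equivalence-preserving conversion from logic programming semantics to classical semantics. $\varphi_r$ is over the atoms of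 $L_g$ and possibly finitely many additional auxiliary atoms. The defining property of the conversion is that $SAT(\varphi_r)=MOD(L_g)$, where $SAT$ denotes the set of classical models and the auxiliary atoms are omitted from the models in $SAT(\varphi_r)$; in every model of $\varphi_r$ the truth values of the auxiliary atoms are uniquely determined by those of the original atoms. $\varphi_e$ is the conjunction of the unit clauses $a$ for each $a\in\mathbf{E}$ that is true in $\mathbf{e}$ and $\neg a$ for each $a\in\mathbf{E}$ that is false in $\mathbf{e}$. Put $\varphi=\varphi_r\wedge\varphi_e$. **Corresponding ground Markov Logic Network $\mathcal{M}$.** A ground Markov Logic Network (MLN) is a finite set of pairs (ground formula, weight). It defines the log-linear distribution over truth assignments $\omega$ to its atoms in which $P(\omega)$ is proportional to $\exp$ of the sum of the weights of the formulas satisfied by $\omega$; a *hard* clause (weight infinity) means that every world violating it has probability $0$ (and it contributes no factor otherwise). The MLN $\mathcal{M}$, over the atoms of $L_g$ and the auxiliary atoms, contains every clause of $\varphi$ as a hard clause and, for each probabilistic fact $p_f::f$ of $L_g$, the unit clause $f$ with weight $\ln(p_f)$ and the unit clause $\neg f$ with weight $\ln(1-p_f)$ (with the convention $\exp(\ln 0)=0$). *)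

theory Defs
  imports Complex_Main "HOL-Library.Extended_Real" "HOL-Library.Product_Order"
begin

datatype 'a literal = Pos (lit_atom: 'a) | Neg (lit_atom: 'a)

datatype 'a rule = Rule (head: 'a) (body: "'a literal list")

abbreviation fact_rule :: "'a \<Rightarrow> 'a rule" where
  "fact_rule a \<equiv> Rule a []"

text \<open>A partial interpretation is a pair (set of true atoms, set of false atoms).\<close>

type_synonym 'a pinterp = "'a set \<times> 'a set"

fun lit_true :: "'a pinterp \<Rightarrow> 'a literal \<Rightarrow> bool" where
  "lit_true I (Pos a) \<longleftrightarrow> a \<in> fst I"
| "lit_true I (Neg a) \<longleftrightarrow> a \<in> snd I"

fun lit_false :: "'a pinterp \<Rightarrow> 'a literal \<Rightarrow> bool" where
  "lit_false I (Pos a) \<longleftrightarrow> a \<in> snd I"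
| "lit_false I (Neg a) \<longleftrightarrow> a \<in> fst I"

definition immediate_conseq :: "'a rule set \<Rightarrow> 'a pinterp \<Rightarrow> 'a set" where
  "immediate_conseq P I = {head r | r. r \<in> P \<and> (\<forall>l\<in>set (body r). lit_true I l)}"

definition unfounded :: "'a rule set \<Rightarrow> 'a pinterp \<Rightarrow> 'a set \<Rightarrow> bool" where
  "unfounded P I U \<longleftrightarrow> (\<forall>r\<in>P. head r \<in> U \<longrightarrow>
     (\<exists>l\<in>set (body r). lit_false I l \<or> (\<exists>b\<in>U. l = Pos b)))"

definition greatest_unfounded :: "'a set \<Rightarrow> 'a rule set \<Rightarrow> 'a pinterp \<Rightarrow> 'a set" where
  "greatest_unfounded A P I = \<Union>{U. U \<subseteq> A \<and> unfounded P I U}"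

text \<open>
  The well-founded model of a ground program \<open>P\<close> over the atoms \<open>A\<close>, as introduced by Van Gelder,
  Ross and Schlipf. Pairs are ordered componentwise, i.e. by information content.
\<close>

definition wfm :: "'a set \<Rightarrow> 'a rule set \<Rightarrow> 'a pinterp" where
  "wfm A P = lfp (\<lambda>I. (immediate_conseq P I, greatest_unfounded A P I))"

lemma mono_wfm_step: "mono (\<lambda>I. (immediate_conseq P I, greatest_unfounded A P I))"
proof (rule monoI)
  fix I J :: "'a pinterp"
  assume "I \<le> J"
  then have sub: "fst I \<subseteq> fst J" "snd I \<subseteq> snd J"
    by (auto simp: less_eq_prod_def)
  have T: "lit_true J l" if "lit_true I l" for l
    using that sub by (cases l) auto
  have F: "lit_false J l" if "lit_false I l" for l
    using that sub by (cases l) auto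
  have "immediate_conseq P I \<subseteq> immediate_conseq P J"
    unfolding immediate_conseq_def using T by blast
  moreover have "unfounded P J U" if "unfounded P I U" for U
    using that F unfolding unfounded_def by meson
  then have "greatest_unfounded A P I \<subseteq> greatest_unfounded A P J"
    unfolding greatest_unfounded_def by blast
  ultimately show "(immediate_conseq P I, greatest_unfounded A P I)
      \<le> (immediate_conseq P J, greatest_unfounded A P J)"
    by (simp add: less_eq_prod_def)
qed

text \<open>
  A world over the atoms \<open>A\<close> is represented by the set \<open>w \<subseteq> A\<close> of its true atoms; as a partial
  interpretation it is the pair \<open>(w, A - w)\<close>.
\<close>

definition wfm_is_world :: "'a set \<Rightarrow> 'a rule set \<Rightarrow> 'a set \<Rightarrow> bool" where
  "wfm_is_world A P w \<longleftrightarrow> w \<subseteq> A \<and> wfm A P = (w, A - w)"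

definition assigns :: "'a set \<Rightarrow> ('a \<Rightarrow> bool) \<Rightarrow> 'a set set" where
  "assigns S v = {w. \<forall>a\<in>S. a \<in> w \<longleftrightarrow> v a}"

record 'a gproblog =
  gatoms :: "'a set"
  gpfacts :: "(real \<times> 'a) set"
  grules :: "'a rule set"

definition prob_atoms :: "'a gproblog \<Rightarrow> 'a set" where
  "prob_atoms G = snd ` gpfacts G"

definition derived_atoms :: "'a gproblog \<Rightarrow> 'a set" where
  "derived_atoms G = head ` grules G"

text \<open>Meaningful only for atoms carrying exactly one probability.\<close>

definition fact_prob :: "'a gproblog \<Rightarrow> 'a \<Rightarrow> real" where
  "fact_prob G f = (THE p. (p, f) \<in> gpfacts G)"

definition choice_prob :: "'a gproblog \<Rightarrow> 'a set \<Rightarrow> real" where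
  "choice_prob G C =
     (\<Prod>f\<in>C. fact_prob G f) * (\<Prod>f\<in>prob_atoms G - C. 1 - fact_prob G f)"

definition choice_model :: "'a gproblog \<Rightarrow> 'a set \<Rightarrow> 'a set \<Rightarrow> bool" where
  "choice_model G C w \<longleftrightarrow>
     C \<subseteq> prob_atoms G \<and> wfm_is_world (gatoms G) (fact_rule ` C \<union> grules G) w"

definition MOD :: "'a gproblog \<Rightarrow> 'a set set" where
  "MOD G = {w. \<exists>C. choice_model G C w}"

definition world_prob :: "'a gproblog \<Rightarrow> 'a set \<Rightarrow> real" where
  "world_prob G w = (if w \<in> MOD G then choice_prob G (THE C. choice_model G C w) else 0)"

text \<open>
  The sum ranges over the models in the event only: all other worlds have probability \<open>0\<close>, and
  there are finitely many models even if there are infinitely many atoms.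
\<close>

definition event_prob :: "'a gproblog \<Rightarrow> 'a set set \<Rightarrow> real" where
  "event_prob G S = (\<Sum>w\<in>MOD G \<inter> S. world_prob G w)"

definition event_cond_prob :: "'a gproblog \<Rightarrow> 'a set set \<Rightarrow> 'a set set \<Rightarrow> real" where
  "event_cond_prob G S T = event_prob G (S \<inter> T) / event_prob G T"

datatype ('f, 'v) trm = Var 'v | Fun 'f "('f, 'v) trm list"

datatype 'f gterm = GFun 'f "'f gterm list"

datatype ('p, 't) atm = Atm (pred: 'p) (args: "'t list")

type_synonym ('p, 'f, 'v) foatom = "('p, ('f, 'v) trm) atm"
type_synonym ('p, 'f) gatom = "('p, 'f gterm) atm"

fun trm_vars :: "('f, 'v) trm \<Rightarrow> 'v set" where
  "trm_vars (Var x) = {x}"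
| "trm_vars (Fun f ts) = (\<Union>t\<in>set ts. trm_vars t)"

fun trm_funs :: "('f, 'v) trm \<Rightarrow> ('f \<times> nat) set" where
  "trm_funs (Var x) = {}"
| "trm_funs (Fun f ts) = insert (f, length ts) (\<Union>t\<in>set ts. trm_funs t)"

fun trm_ground :: "('v \<Rightarrow> 'f gterm) \<Rightarrow> ('f, 'v) trm \<Rightarrow> 'f gterm" where
  "trm_ground s (Var x) = s x"
| "trm_ground s (Fun f ts) = GFun f (map (trm_ground s) ts)"

definition atm_vars :: "('p, 'f, 'v) foatom \<Rightarrow> 'v set" where
  "atm_vars a = (\<Union>t\<in>set (args a). trm_vars t)"

definition atm_ground :: "('v \<Rightarrow> 'f gterm) \<Rightarrow> ('p, 'f, 'v) foatom \<Rightarrow> ('p, 'f) gatom" where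
  "atm_ground s a = Atm (pred a) (map (trm_ground s) (args a))"

text \<open>
  A program comes with its signature, a set of function symbols (constants being those of arity
  \<open>0\<close>) and a set of predicate symbols, which may contain more than the symbols that occur in it,
  for instance an additional constant.
\<close>

record ('p, 'f, 'v) problog =
  sig_funs :: "('f \<times> nat) set"
  sig_preds :: "('p \<times> nat) set"
  pfacts :: "(real \<times> ('p, 'f, 'v) foatom) set"
  prules :: "('p, 'f, 'v) foatom rule set"

inductive_set herbrand_universe :: "('f \<times> nat) set \<Rightarrow> 'f gterm set"
  for S :: "('f \<times> nat) set" where
  "(f, length ts) \<in> S \<Longrightarrow> \<forall>t\<in>set ts. t \<in> herbrand_universe S \<Longrightarrow> GFun f ts \<in> herbrand_universe S"

definition herbrand_base :: "('p, 'f, 'v) problog \<Rightarrow> ('p, 'f) gatom set" where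
  "herbrand_base L = {a. (pred a, length (args a)) \<in> sig_preds L \<and>
     set (args a) \<subseteq> herbrand_universe (sig_funs L)}"

definition atm_in_sig :: "('p, 'f, 'v) problog \<Rightarrow> ('p, 'f, 'v) foatom \<Rightarrow> bool" where
  "atm_in_sig L a \<longleftrightarrow> (pred a, length (args a)) \<in> sig_preds L \<and>
     (\<forall>t\<in>set (args a). trm_funs t \<subseteq> sig_funs L)"

text \<open>\<open>map_rule\<close> and \<open>set_rule\<close> act on, respectively collect, all atoms of a rule.\<close>

definition grounding :: "('p, 'f, 'v) problog \<Rightarrow> ('p, 'f) gatom gproblog" where
  "grounding L = \<lparr>
     gatoms = herbrand_base L,
     gpfacts = {(p, atm_ground s f) | p f s.
       (p, f) \<in> pfacts L \<and> s ` atm_vars f \<subseteq> herbrand_universe (sig_funs L)},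
     grules = {map_rule (atm_ground s) r | r s.
       r \<in> prules L \<and> s ` (\<Union>a\<in>set_rule r. atm_vars a) \<subseteq> herbrand_universe (sig_funs L)}\<rparr>"

definition problog_program :: "('p, 'f, 'v) problog \<Rightarrow> bool" where
  "problog_program L \<longleftrightarrow>
     (\<forall>(p, f)\<in>pfacts L. 0 \<le> p \<and> p \<le> 1 \<and> atm_in_sig L f) \<and>
     (\<forall>r\<in>prules L. \<forall>a\<in>set_rule r. atm_in_sig L a) \<and>
     finite (prob_atoms (grounding L)) \<and>
     (\<forall>f\<in>prob_atoms (grounding L). \<exists>!p. (p, f) \<in> gpfacts (grounding L)) \<and>
     prob_atoms (grounding L) \<inter> derived_atoms (grounding L) = {} \<and>
     (\<forall>C\<subseteq>prob_atoms (grounding L). \<exists>w. choice_model (grounding L) C w)"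

text \<open>Evidence is a set \<open>E\<close> of atoms with truth values \<open>e\<close>; \<open>e\<close> is irrelevant outside \<open>E\<close>.\<close>

fun evidence_false :: "'a set \<Rightarrow> ('a \<Rightarrow> bool) \<Rightarrow> 'a literal \<Rightarrow> bool" where
  "evidence_false E e (Pos a) \<longleftrightarrow> a \<in> E \<and> \<not> e a"
| "evidence_false E e (Neg a) \<longleftrightarrow> a \<in> E \<and> e a"

definition inactive :: "'a set \<Rightarrow> ('a \<Rightarrow> bool) \<Rightarrow> 'a rule \<Rightarrow> bool" where
  "inactive E e r \<longleftrightarrow> (\<exists>l\<in>set (body r). evidence_false E e l)"

inductive_set relevant_atoms ::
    "'a gproblog \<Rightarrow> 'a set \<Rightarrow> 'a set \<Rightarrow> ('a \<Rightarrow> bool) \<Rightarrow> 'a set"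
  for G :: "'a gproblog" and Q E :: "'a set" and e :: "'a \<Rightarrow> bool" where
  base: "a \<in> Q \<union> E \<Longrightarrow> a \<in> relevant_atoms G Q E e"
| step: "r \<in> grules G \<Longrightarrow> \<not> inactive E e r \<Longrightarrow> head r \<in> relevant_atoms G Q E e \<Longrightarrow>
    l \<in> set (body r) \<Longrightarrow> lit_atom l \<in> relevant_atoms G Q E e"

definition relevant_program ::
    "('p, 'f, 'v) problog \<Rightarrow> ('p, 'f) gatom set \<Rightarrow> ('p, 'f) gatom set \<Rightarrow>
     (('p, 'f) gatom \<Rightarrow> bool) \<Rightarrow> ('p, 'f) gatom gproblog" where
  "relevant_program L Q E e =
     (let G = grounding L; A = relevant_atoms G Q E e in \<lparr>
        gatoms = A,
        gpfacts = {(p, f) \<in> gpfacts G. f \<in> A},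
        grules = {r \<in> grules G. \<not> inactive E e r \<and> head r \<in> A}\<rparr>)"

type_synonym 'a clause = "'a literal list"
type_synonym 'a cnf = "'a clause set"

fun lit_holds :: "'a set \<Rightarrow> 'a literal \<Rightarrow> bool" where
  "lit_holds w (Pos a) \<longleftrightarrow> a \<in> w"
| "lit_holds w (Neg a) \<longleftrightarrow> a \<notin> w"

definition cnf_holds :: "'a set \<Rightarrow> 'a cnf \<Rightarrow> bool" where
  "cnf_holds w phi \<longleftrightarrow> (\<forall>c\<in>phi. \<exists>l\<in>set c. lit_holds w l)"

definition cnf_models :: "'a set \<Rightarrow> 'a cnf \<Rightarrow> 'a set set" where
  "cnf_models V phi = {w. w \<subseteq> V \<and> cnf_holds w phi}"

text \<open>
  In \<open>'a + 'x\<close> the original atoms are tagged \<open>Inl\<close> and the auxiliary atoms \<open>Inr\<close>;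
  \<open>drop_aux\<close> omits the latter from a world.
\<close>

definition cnf_vocab :: "'a gproblog \<Rightarrow> 'x set \<Rightarrow> ('a + 'x) set" where
  "cnf_vocab G X = Inl ` gatoms G \<union> Inr ` X"

definition drop_aux :: "('a + 'x) set \<Rightarrow> 'a set" where
  "drop_aux w = {a. Inl a \<in> w}"

definition rule_cnf :: "'a gproblog \<Rightarrow> 'x set \<Rightarrow> ('a + 'x) cnf \<Rightarrow> bool" where
  "rule_cnf G X phi \<longleftrightarrow>
     finite X \<and> finite phi \<and>
     (\<forall>c\<in>phi. \<forall>l\<in>set c. lit_atom l \<in> cnf_vocab G X) \<and>
     drop_aux ` cnf_models (cnf_vocab G X) phi = MOD G \<and>
     inj_on drop_aux (cnf_models (cnf_vocab G X) phi)"

definition evidence_cnf :: "'a set \<Rightarrow> ('a \<Rightarrow> bool) \<Rightarrow> ('a + 'x) cnf" where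
  "evidence_cnf E e = {[if e a then Pos (Inl a) else Neg (Inl a)] | a. a \<in> E}"

datatype 'a form =
  FFalse | FAtom 'a | FNot "'a form" | FAnd "'a form" "'a form" | FOr "'a form" "'a form"

primrec form_holds :: "'a set \<Rightarrow> 'a form \<Rightarrow> bool" where
  "form_holds w FFalse \<longleftrightarrow> False"
| "form_holds w (FAtom a) \<longleftrightarrow> a \<in> w"
| "form_holds w (FNot F) \<longleftrightarrow> \<not> form_holds w F"
| "form_holds w (FAnd F H) \<longleftrightarrow> form_holds w F \<and> form_holds w H"
| "form_holds w (FOr F H) \<longleftrightarrow> form_holds w F \<or> form_holds w H"

fun lit_form :: "'a literal \<Rightarrow> 'a form" where
  "lit_form (Pos a) = FAtom a"
| "lit_form (Neg a) = FNot (FAtom a)"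

definition clause_form :: "'a clause \<Rightarrow> 'a form" where
  "clause_form c = foldr (\<lambda>l. FOr (lit_form l)) c FFalse"

text \<open>
  Weights are extended reals: \<open>\<infinity>\<close> marks a hard formula, and \<open>-\<infinity>\<close> arises as the logarithm of \<open>0\<close>.
\<close>

type_synonym 'a mln = "('a form \<times> ereal) set"

text \<open>The real-valued \<open>ln 0\<close> is \<open>0\<close>.\<close>

definition log_weight :: "real \<Rightarrow> ereal" where
  "log_weight p = (if p = 0 then - \<infinity> else ereal (ln p))"

text \<open>The value at \<open>\<infinity>\<close> is never used, since hard formulas do not contribute to the sum below.\<close>

definition exp_weight :: "ereal \<Rightarrow> real" where
  "exp_weight x = (if x = - \<infinity> then 0 else exp (real_of_ereal x))"

definition mln_weight :: "'a mln \<Rightarrow> 'a set \<Rightarrow> real" where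
  "mln_weight M w =
     (if \<forall>F. (F, \<infinity>) \<in> M \<longrightarrow> form_holds w F
      then exp_weight (\<Sum>(F, wt)\<in>{(F, wt) \<in> M. wt \<noteq> \<infinity> \<and> form_holds w F}. wt)
      else 0)"

definition mln_prob :: "'a set \<Rightarrow> 'a mln \<Rightarrow> 'a set set \<Rightarrow> real" where
  "mln_prob V M S =
     (\<Sum>w\<in>Pow V \<inter> S. mln_weight M w) / (\<Sum>w\<in>Pow V. mln_weight M w)"

definition problog_mln :: "'a gproblog \<Rightarrow> ('a + 'x) cnf \<Rightarrow> ('a + 'x) mln" where
  "problog_mln G phi =
     {(clause_form c, \<infinity>) | c. c \<in> phi} \<union>
     {(clause_form [Pos (Inl f)], log_weight p) | p f. (p, f) \<in> gpfacts G} \<union>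
     {(clause_form [Neg (Inl f)], log_weight (1 - p)) | p f. (p, f) \<in> gpfacts G}"

end

(*
  A total choice can be read off its well-founded model, because a probabilistic atom heads no rule
  other than its own fact. So a model of L_g determines its choice, and its probability is the
  product over the probabilistic atoms of p or 1 - p according to their truth value; this is also
  the exponential of the sum of the soft weights. Since the auxiliary atoms are determined by the
  original ones, the worlds of positive weight in M correspond one-to-one to models of L_g that
  agree with the evidence, and the normalising constant of M is P(E = e).
*)

theory Submission
  imports Defs
begin

text \<open>A summand \<open>-\<infinity>\<close> absorbs every finite one, just as its image 0
  absorbs under multiplication. The value \<open>\<infinity>\<close> must be kept out:
  \<open>\<infinity> + -\<infinity>\<close> is \<open>\<infinity>\<close> in
  \<open>ereal\<close>.\<close>

lemma exp_weight_add:
  assumes "a \<noteq> \<infinity>" "b \<noteq> \<infinity>"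
  shows "exp_weight (a + b) = exp_weight a * exp_weight b"
  using assms by (cases a; cases b) (auto simp: exp_weight_def exp_add)

lemma exp_weight_sum:
  fixes f :: "'b \<Rightarrow> ereal"
  assumes "finite S" "\<And>x. x \<in> S \<Longrightarrow> f x \<noteq> \<infinity>"
  shows "exp_weight (sum f S) = (\<Prod>x\<in>S. exp_weight (f x))"
  using assms
proof (induction S rule: finite_induct)
  case empty
  then show ?case by (simp add: exp_weight_def)
next
  case (insert x S)
  moreover have "sum f S \<noteq> \<infinity>"
    using insert.prems by (auto simp: sum_Pinfty)
  ultimately show ?case by (simp add: exp_weight_add)
qed

lemma log_weight_neq_PInf [simp]: "log_weight p \<noteq> \<infinity>"
  by (simp add: log_weight_def)

lemma exp_log_weight: "0 \<le> p \<Longrightarrow> exp_weight (log_weight p) = p"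
  by (simp add: log_weight_def exp_weight_def)

lemma form_holds_lit_form: "form_holds w (lit_form l) \<longleftrightarrow> lit_holds w l"
  by (cases l) auto

lemma form_holds_clause_form: "form_holds w (clause_form c) \<longleftrightarrow> (\<exists>l\<in>set c. lit_holds w l)"
  by (induction c) (auto simp: clause_form_def form_holds_lit_form)

lemma form_holds_unit_clause: "form_holds w (clause_form [l]) \<longleftrightarrow> lit_holds w l"
  by (simp add: form_holds_clause_form)

text \<open>An MLN is a set of pairs, so equal weights of different atoms stay separate only if
  their formulas differ.\<close>

lemma clause_form_unit_eq_iff: "clause_form [l] = clause_form [m] \<longleftrightarrow> l = m"
  by (cases l; cases m) (auto simp: clause_form_def)

lemma cnf_models_evidence:
  "cnf_models V (phi \<union> evidence_cnf E e) = {w \<in> cnf_models V phi. drop_aux w \<in> assigns E e}"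
proof -
  have "cnf_holds w (evidence_cnf E e) \<longleftrightarrow> drop_aux w \<in> assigns E e" for w :: "('a + 'b) set"
    by (auto simp: cnf_holds_def evidence_cnf_def assigns_def drop_aux_def split: if_splits)
  moreover have "cnf_holds w (phi \<union> evidence_cnf E e) \<longleftrightarrow>
      cnf_holds w phi \<and> cnf_holds w (evidence_cnf E e)" for w
    by (auto simp: cnf_holds_def)
  ultimately show ?thesis
    by (auto simp: cnf_models_def)
qed

lemma wfm_unfold:
  "wfm A P = (immediate_conseq P (wfm A P), greatest_unfounded A P (wfm A P))"
  unfolding wfm_def by (rule lfp_unfold[OF mono_wfm_step])

text \<open>These conditions hold for \<open>grounding L\<close> and survive the restriction to
  relevant atoms, so the argument about the MLN can be carried out for an abstract ground
  program.\<close>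

locale ground_problog =
  fixes G :: "'a gproblog"
  assumes finite_prob_atoms: "finite (prob_atoms G)"
    and ex1_prob: "f \<in> prob_atoms G \<Longrightarrow> \<exists>!p. (p, f) \<in> gpfacts G"
    and prob_range: "(p, f) \<in> gpfacts G \<Longrightarrow> 0 \<le> p \<and> p \<le> 1"
    and prob_derived_disjoint: "prob_atoms G \<inter> derived_atoms G = {}"
begin

lemma gpfacts_iff: "(p, f) \<in> gpfacts G \<longleftrightarrow> f \<in> prob_atoms G \<and> p = fact_prob G f"
proof -
  have "(p, f) \<in> gpfacts G \<Longrightarrow> f \<in> prob_atoms G"
    by (force simp: prob_atoms_def)
  moreover have "f \<in> prob_atoms G \<Longrightarrow> (fact_prob G f, f) \<in> gpfacts G"
    unfolding fact_prob_def by (rule theI') (rule ex1_prob)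
  ultimately show ?thesis
    using ex1_prob by blast
qed

lemma choice_model_imp_choice:
  assumes "choice_model G C w"
  shows "C = w \<inter> prob_atoms G"
proof -
  let ?P = "fact_rule ` C \<union> grules G"
  have C: "C \<subseteq> prob_atoms G" and wfm: "wfm (gatoms G) ?P = (w, gatoms G - w)"
    using assms by (auto simp: choice_model_def wfm_is_world_def)
  have "w = immediate_conseq ?P (w, gatoms G - w)"
    using wfm_unfold[of "gatoms G" ?P] wfm by simp
  \<comment> \<open>This holds for every \<open>I\<close>: the only rule that can have head
    \<open>f\<close> is its fact, and the empty body of that fact is true everywhere.\<close>
  moreover have "f \<in> immediate_conseq ?P I \<longleftrightarrow> f \<in> C" if "f \<in> prob_atoms G" for f I
    using that prob_derived_disjoint
    by (force simp: immediate_conseq_def derived_atoms_def)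
  ultimately show ?thesis
    using C by blast
qed

lemma world_prob_MOD:
  assumes "w \<in> MOD G"
  shows "world_prob G w = choice_prob G (w \<inter> prob_atoms G)"
proof -
  obtain C where "choice_model G C w"
    using assms by (auto simp: MOD_def)
  then have "(THE C. choice_model G C w) = w \<inter> prob_atoms G"
    using choice_model_imp_choice by (intro the_equality) auto
  then show ?thesis
    using assms by (simp add: world_prob_def)
qed

text \<open>A single product over all probabilistic atoms matches the MLN side, where each such atom
  contributes one satisfied soft clause.\<close>

lemma choice_prob_prod:
  "choice_prob G (w \<inter> prob_atoms G) =
     (\<Prod>f\<in>prob_atoms G. if f \<in> w then fact_prob G f else 1 - fact_prob G f)"
proof -
  have "prob_atoms G \<inter> {f. f \<in> w} = w \<inter> prob_atoms G"
    and "prob_atoms G \<inter> - {f. f \<in> w} = prob_atoms G - w \<inter> prob_atoms G"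
    by auto
  then show ?thesis
    by (simp add: choice_prob_def prod.If_cases[OF finite_prob_atoms])
qed

lemma problog_mln_hard_iff:
  "(\<forall>F. (F, \<infinity>) \<in> problog_mln G phi \<longrightarrow> form_holds w F) \<longleftrightarrow> cnf_holds w phi"
proof -
  have "(F, \<infinity>) \<in> problog_mln G phi \<longleftrightarrow> (\<exists>c\<in>phi. F = clause_form c)" for F
    by (auto simp: problog_mln_def log_weight_neq_PInf[THEN not_sym])
  then show ?thesis
    by (auto simp: cnf_holds_def form_holds_clause_form)
qed

lemma mln_weight_problog_mln:
  fixes w :: "('a + 'x) set"
  assumes "cnf_holds w phi"
  shows "mln_weight (problog_mln G phi) w = choice_prob G (drop_aux w \<inter> prob_atoms G)"
proof -
  \<comment> \<open>\<open>l f\<close> is whichever of the two unit literals on \<open>f\<close> is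
    true in \<open>w\<close>, and \<open>p f\<close> is the probability whose logarithm weights
    it.\<close>
  define l where "l f = (if f \<in> drop_aux w then Pos (Inl f) else Neg (Inl f) :: ('a + 'x) literal)" for f
  define p where "p f = (if f \<in> drop_aux w then fact_prob G f else 1 - fact_prob G f)" for f
  let ?h = "\<lambda>f. (clause_form [l f], log_weight (p f))"
  have soft: "{(F, wt) \<in> problog_mln G phi. wt \<noteq> \<infinity> \<and> form_holds w F} = ?h ` prob_atoms G"
    by (auto simp: problog_mln_def gpfacts_iff form_holds_unit_clause l_def p_def drop_aux_def
        image_iff log_weight_neq_PInf[THEN not_sym])
  \<comment> \<open>Injectivity of \<open>l\<close> suffices, so atoms sharing a probability are
    each counted in the sum.\<close>
  have inj: "inj_on ?h (prob_atoms G)"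
    by (auto simp: inj_on_def clause_form_unit_eq_iff l_def split: if_splits)
  have nonneg: "0 \<le> p f" if "f \<in> prob_atoms G" for f
    using that prob_range[of "fact_prob G f" f] by (auto simp: p_def gpfacts_iff)
  have "mln_weight (problog_mln G phi) w = exp_weight (\<Sum>(F, wt)\<in>?h ` prob_atoms G. wt)"
    using assms unfolding mln_weight_def problog_mln_hard_iff soft by simp
  also have "\<dots> = exp_weight (\<Sum>f\<in>prob_atoms G. log_weight (p f))"
    by (simp add: sum.reindex[OF inj])
  also have "\<dots> = (\<Prod>f\<in>prob_atoms G. p f)"
    using nonneg by (simp add: exp_weight_sum finite_prob_atoms exp_log_weight)
  also have "\<dots> = choice_prob G (drop_aux w \<inter> prob_atoms G)"
    by (simp add: choice_prob_prod p_def)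
  finally show ?thesis .
qed

text \<open>An arbitrary \<open>S\<close> covers both parts of the quotient \<open>mln_prob\<close>:
  the event itself gives the numerator and \<open>UNIV\<close> the normalising constant.\<close>

lemma sum_mln_weight_problog_mln:
  fixes phi_r :: "('a + 'x) cnf"
  assumes "finite (gatoms G)" and cnf: "rule_cnf G X phi_r"
  shows "(\<Sum>w\<in>Pow (cnf_vocab G X) \<inter> {w. drop_aux w \<in> S}.
      mln_weight (problog_mln G (phi_r \<union> evidence_cnf E e)) w) = event_prob G (S \<inter> assigns E e)"
proof -
  let ?V = "cnf_vocab G X" and ?phi = "phi_r \<union> evidence_cnf E e"
  let ?wt = "mln_weight (problog_mln G ?phi)"
  let ?N = "{w \<in> cnf_models ?V phi_r. drop_aux w \<in> S \<inter> assigns E e}"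
  have img: "drop_aux ` cnf_models ?V phi_r = MOD G"
    and inj: "inj_on drop_aux (cnf_models ?V phi_r)" and "finite X"
    using cnf by (auto simp: rule_cnf_def)
  have "finite (Pow ?V)"
    using assms(1) \<open>finite X\<close> by (simp add: cnf_vocab_def)
  moreover have N: "?N = {w \<in> Pow ?V \<inter> {w. drop_aux w \<in> S}. cnf_holds w ?phi}"
    using cnf_models_evidence[of ?V phi_r E e] by (auto simp: cnf_models_def)
  \<comment> \<open>A world outside \<open>?N\<close> violates a hard clause and has weight
    0.\<close>
  ultimately have "(\<Sum>w\<in>Pow ?V \<inter> {w. drop_aux w \<in> S}. ?wt w) = (\<Sum>w\<in>?N. ?wt w)"
    by (intro sum.mono_neutral_right) (auto simp: mln_weight_def problog_mln_hard_iff)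
  also have "\<dots> = (\<Sum>w\<in>?N. world_prob G (drop_aux w))"
  proof (rule sum.cong[OF refl])
    fix w assume w: "w \<in> ?N"
    then have "drop_aux w \<in> MOD G"
      using img by blast
    moreover have "cnf_holds w ?phi"
      using w N by blast
    ultimately show "?wt w = world_prob G (drop_aux w)"
      by (simp add: world_prob_MOD mln_weight_problog_mln)
  qed
  also have "\<dots> = (\<Sum>w\<in>drop_aux ` ?N. world_prob G w)"
    \<comment> \<open>Each model of \<open>Lg\<close> in the event is counted once because the
      auxiliary atoms are determined by the others.\<close>
    using inj by (subst sum.reindex) (auto intro: inj_on_subset)
  also have "drop_aux ` ?N = MOD G \<inter> (S \<inter> assigns E e)"
    unfolding img[symmetric] by blast
  finally show ?thesis
    by (simp add: event_prob_def)
qed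

theorem mln_prob_problog_mln:
  fixes phi_r :: "('a + 'x) cnf"
  assumes "finite (gatoms G)" "rule_cnf G X phi_r"
  shows "mln_prob (cnf_vocab G X) (problog_mln G (phi_r \<union> evidence_cnf E e)) {w. drop_aux w \<in> S}
       = event_cond_prob G S (assigns E e)"
  using sum_mln_weight_problog_mln[OF assms, where S = S and E = E and e = e]
    \<comment> \<open>Numerators and denominators of the two quotients agree separately.\<close>
    sum_mln_weight_problog_mln[OF assms, where S = UNIV and E = E and e = e]
  by (simp add: mln_prob_def event_cond_prob_def)

end

lemma ground_problog_grounding:
  assumes "problog_program L"
  shows "ground_problog (grounding L)"
proof
  show "0 \<le> p \<and> p \<le> 1" if "(p, f) \<in> gpfacts (grounding L)" for p f
    using that assms by (fastforce simp: grounding_def problog_program_def)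
qed (use assms in \<open>auto simp: problog_program_def\<close>)

text \<open>Facts are selected by their atom alone, so a relevant probabilistic atom keeps its one
  probability, and dropping rules only shrinks the set of derived atoms.\<close>

lemma ground_problog_relevant_program:
  assumes "problog_program L"
  shows "ground_problog (relevant_program L Q E e)"
proof -
  interpret G: ground_problog "grounding L"
    using assms by (rule ground_problog_grounding)
  let ?R = "relevant_program L Q E e"
  have facts: "gpfacts ?R =
      {(p, f) \<in> gpfacts (grounding L). f \<in> relevant_atoms (grounding L) Q E e}"
    by (simp add: relevant_program_def Let_def)
  have prob: "prob_atoms ?R = prob_atoms (grounding L) \<inter> relevant_atoms (grounding L) Q E e"
    by (force simp: prob_atoms_def facts)
  have derived: "derived_atoms ?R \<subseteq> derived_atoms (grounding L)"
    by (auto simp: derived_atoms_def relevant_program_def Let_def)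
  show ?thesis
  proof
    show "finite (prob_atoms ?R)"
      by (simp add: prob G.finite_prob_atoms)
    show "\<exists>!p. (p, f) \<in> gpfacts ?R" if "f \<in> prob_atoms ?R" for f
      using that G.ex1_prob by (simp add: prob facts)
    show "0 \<le> p \<and> p \<le> 1" if "(p, f) \<in> gpfacts ?R" for p f
      using that G.prob_range[of p f] by (simp add: facts)
    show "prob_atoms ?R \<inter> derived_atoms ?R = {}"
      using prob derived G.prob_derived_disjoint by blast
  qed
qed

theorem theorem3:
  fixes L :: "('p, 'f, 'v) problog"
    and Q E :: "('p, 'f) gatom set"
    and e q :: "('p, 'f) gatom \<Rightarrow> bool"
    and Lg :: "('p, 'f) gatom gproblog"
    and X :: "'x set"
    and phi_r phi :: "(('p, 'f) gatom + 'x) cnf"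
    and M :: "(('p, 'f) gatom + 'x) mln"
  assumes "problog_program L"
    and "Q \<subseteq> prob_atoms (grounding L) \<union> derived_atoms (grounding L)"
    and "E \<subseteq> prob_atoms (grounding L) \<union> derived_atoms (grounding L)"
    and "Lg = relevant_program L Q E e"
    and "finite (gatoms Lg)" and "finite (grules Lg)"
    and "event_prob Lg (assigns E e) > 0"
    and "rule_cnf Lg X phi_r"
    and "phi = phi_r \<union> evidence_cnf E e"
    and "M = problog_mln Lg phi"
  shows "mln_prob (cnf_vocab Lg X) M {w. drop_aux w \<in> assigns Q q}
       = event_cond_prob Lg (assigns Q q) (assigns E e)"
proof -
  interpret ground_problog Lg
    unfolding assms(4) using assms(1) by (rule ground_problog_relevant_program)
  show ?thesis
    unfolding assms(9,10) using assms(5,8) by (rule mln_prob_problog_mln)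
qed

end
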